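(* The functions sending $(1^n\,0\,1^k)$ to the Stirling number of the first type $c(n,k)$ and to the Stirling number of the second type $S(n,k)$, respectively, are both in $\#\mathsf{L}$.
   Context: $c(n,k)$ is the (unsigned) Stirling number of the first type: the number of permutations of $n$ elements with exactly $k$ cycles; it satisfies $c(n+1,k)=n\,c(n,k)+c(n,k-1)$. $S(n,k)$ is the Stirling number of the second type: the number of set partitions of an $n$-element set into $k$ nonempty blocks; it satisfies $S(n+1,k)=k\,S(n,k)+S(n,k-1)$. The alphabet is $\Sigma=\{0,1\}$; $1^a$ is the string of $a$ ones and juxtaposition is concatenation. A function given only on strings of a displayed form is extended by $0$ to all other strings. $\#\mathsf{L}$ is the class of functions $f:\Sigma^*\to\mathbb{N}_0$ such that $f(x)$ is the number of accepting computation paths on input $x$ of a fixed nondeterministic Turing machine with read-only input tape that uses $O(\log|x|)$ work space and halts on every computation path. Equivalently: there are a polynomial $q$ and a deterministic $O(\log|x|)$-space Turing machine $M$ with an additional read-once, left-to-right witness tape such that $f(x)=\#\{w\in\Sigma^{q(|x|)}\mid M(x,w)=\mathsf{yes}\}$. *)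

theory Defs
  imports Complex_Main "HOL-Library.Landau_Symbols" "HOL-Library.Disjoint_Sets"
    "HOL-Combinatorics.Stirling" "HOL-Combinatorics.Orbits"
begin

section \<open>Nondeterministic Turing machines with a read-only input tape\<close>

datatype dir = Lft | Stay | Rgt

text \<open>The input word \<open>x \<in> {0,1}\<^sup>*\<close> is a \<^typ>\<open>bool list\<close> (\<^const>\<open>True\<close> is the letter 1). It occupies
  the cells \<open>1, \<dots>, |x|\<close> of the input tape, between two end markers on the cells \<open>0\<close> and \<open>|x|+1\<close>.\<close>

datatype insym = LeftEnd | Bit bool | RightEnd

definition read_input :: "bool list \<Rightarrow> nat \<Rightarrow> insym" where
  "read_input x i =
     (if i = 0 then LeftEnd else if i \<le> length x then Bit (x ! (i - 1)) else RightEnd)"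

text \<open>A transition \<open>((q, a, ws), (q', ws', d, ds))\<close>: in state \<open>q\<close>, scanning the input symbol \<open>a\<close> and
  the symbols \<open>ws\<close> on the work tapes, the machine may go to state \<open>q'\<close>, overwrite the scanned work
  symbols by \<open>ws'\<close>, move the input head in direction \<open>d\<close> and the work heads in directions \<open>ds\<close>.\<close>

type_synonym ('q, 'a) transition =
  "('q \<times> insym \<times> 'a list) \<times> ('q \<times> 'a list \<times> dir \<times> dir list)"

record ('q, 'a) ntm =
  states :: "'q set"
  symbols :: "'a set"
  blank :: 'a
  tapes :: nat
  start :: 'q
  accepting :: "'q set"
  trans :: "('q, 'a) transition set"

definition wf_ntm :: "('q, 'a) ntm \<Rightarrow> bool" where
  "wf_ntm M \<longleftrightarrow>
     finite (states M) \<and> finite (symbols M) \<and> blank M \<in> symbols M \<and>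
     start M \<in> states M \<and> accepting M \<subseteq> states M \<and>
     (\<forall>((q, a, ws), (q', ws', d, ds)) \<in> trans M.
        q \<in> states M \<and> q' \<in> states M \<and>
        set ws \<subseteq> symbols M \<and> set ws' \<subseteq> symbols M \<and>
        length ws = tapes M \<and> length ws' = tapes M \<and> length ds = tapes M)"

text \<open>A work tape, together with its head position, is a pair \<open>(p, t)\<close>; its cells are numbered by the
  natural numbers.\<close>

record ('q, 'a) config =
  cstate :: 'q
  ihead :: nat
  work :: "(nat \<times> (nat \<Rightarrow> 'a)) list"

definition init_config :: "('q, 'a) ntm \<Rightarrow> ('q, 'a) config" where
  "init_config M =
     \<lparr>cstate = start M, ihead = 0, work = replicate (tapes M) (0, \<lambda>_. blank M)\<rparr>"

text \<open>A head told to leave its tape does not move: this concerns the left end of the work tapes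
  (by truncated subtraction) and both ends of the input tape.\<close>

fun move :: "dir \<Rightarrow> nat \<Rightarrow> nat" where
  "move Lft p = p - 1"
| "move Stay p = p"
| "move Rgt p = p + 1"

definition ntm_step :: "('q, 'a) ntm \<Rightarrow> bool list \<Rightarrow> ('q, 'a) config \<Rightarrow> ('q, 'a) config \<Rightarrow> bool" where
  "ntm_step M x c c' \<longleftrightarrow>
     (\<exists>q' ws' d ds.
        ((cstate c, read_input x (ihead c), map (\<lambda>(p, t). t p) (work c)), (q', ws', d, ds)) \<in> trans M \<and>
        c' = \<lparr>cstate = q',
              ihead = min (move d (ihead c)) (length x + 1),
              work = map (\<lambda>((b, e), (p, t)). (move e p, t(p := b))) (zip (zip ws' ds) (work c))\<rparr>)"

definition halting :: "('q, 'a) ntm \<Rightarrow> bool list \<Rightarrow> ('q, 'a) config \<Rightarrow> bool" where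
  "halting M x c \<longleftrightarrow> (\<nexists>c'. ntm_step M x c c')"

text \<open>A path is a sequence of configurations, so two transitions with the same successor configuration
  give the same path. Counting sequences of transitions instead would yield the same class
  \<open>#L\<close>, since a machine can record the last transition in its state.\<close>

definition computation_paths :: "('q, 'a) ntm \<Rightarrow> bool list \<Rightarrow> ('q, 'a) config list set" where
  "computation_paths M x =
     {cs. cs \<noteq> [] \<and> hd cs = init_config M \<and> successively (ntm_step M x) cs \<and> halting M x (last cs)}"

definition accepting_paths :: "('q, 'a) ntm \<Rightarrow> bool list \<Rightarrow> ('q, 'a) config list set" where
  "accepting_paths M x = {cs \<in> computation_paths M x. cstate (last cs) \<in> accepting M}"

definition halts_on_every_path :: "('q, 'a) ntm \<Rightarrow> bool list \<Rightarrow> bool" where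
  "halts_on_every_path M x \<longleftrightarrow>
     (\<nexists>f :: nat \<Rightarrow> ('q, 'a) config. f 0 = init_config M \<and> (\<forall>i. ntm_step M x (f i) (f (Suc i))))"

text \<open>A work head starts in cell \<open>0\<close> and moves by at most one cell per step, so that a head in cell
  \<open>p\<close> has visited at least the \<open>p + 1\<close> cells \<open>0, \<dots>, p\<close>, and the work space is governed by the
  largest head positions (up to a constant factor, the number of tapes).\<close>

definition work_space :: "('q, 'a) config \<Rightarrow> nat" where
  "work_space c = (\<Sum>(p, t) \<leftarrow> work c. p + 1)"

definition runs_in_space :: "('q, 'a) ntm \<Rightarrow> (nat \<Rightarrow> real) \<Rightarrow> bool" where
  "runs_in_space M s \<longleftrightarrow>
     (\<forall>x c. (ntm_step M x)\<^sup>*\<^sup>* (init_config M) c \<longrightarrow> real (work_space c) \<le> s (length x))"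

section \<open>The class \<open>#L\<close>\<close>

text \<open>States and work symbols are natural numbers, which is no restriction since both sets are
  finite. The number of accepting paths is finite, because the transition relation is finite and
  every path halts; so \<^const>\<open>card\<close> is the actual number.\<close>

definition sharpL :: "(bool list \<Rightarrow> nat) set" where
  "sharpL =
     {f. \<exists>M :: (nat, nat) ntm.
           wf_ntm M \<and>
           (\<exists>s. s \<in> O(\<lambda>n. ln (real n)) \<and> runs_in_space M s) \<and>
           (\<forall>x. halts_on_every_path M x) \<and>
           (\<forall>x. f x = card (accepting_paths M x))}"

section \<open>Functions of two numbers given in unary\<close>

definition unary_pair :: "nat \<times> nat \<Rightarrow> bool list" where
  "unary_pair = (\<lambda>(n, k). replicate n True @ [False] @ replicate k True)"

definition on_unary_pairs :: "(nat \<Rightarrow> nat \<Rightarrow> nat) \<Rightarrow> bool list \<Rightarrow> nat" where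
  "on_unary_pairs g x =
     (if x \<in> range unary_pair then case inv unary_pair x of (n, k) \<Rightarrow> g n k else 0)"

lemma inj_unary_pair: "inj unary_pair"
proof (rule injI, clarify)
  fix n k n' k'
  assume eq: "unary_pair (n, k) = unary_pair (n', k')"
  have len: "length (takeWhile id (unary_pair (m, l))) = m" for m l
    by (simp add: unary_pair_def takeWhile_append)
  have n: "n = n'"
    using arg_cong[OF eq, of "\<lambda>x. length (takeWhile id x)"] by (simp add: len)
  moreover have "k = k'"
    using arg_cong[OF eq, of length] n by (simp add: unary_pair_def)
  ultimately show "n = n' \<and> k = k'" by simp
qed

lemma on_unary_pairs_unary_pair:
  "on_unary_pairs g (replicate n True @ [False] @ replicate k True) = g n k"
proof -
  have "on_unary_pairs g (unary_pair (n, k)) = g n k"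
    by (simp add: on_unary_pairs_def inv_f_f[OF inj_unary_pair])
  then show ?thesis by (simp add: unary_pair_def)
qed

lemma on_unary_pairs_other:
  "(\<And>n k. x \<noteq> replicate n True @ [False] @ replicate k True) \<Longrightarrow> on_unary_pairs g x = 0"
  by (auto simp: on_unary_pairs_def unary_pair_def)

section \<open>Combinatorial meaning of the Stirling numbers\<close>

text \<open>The library introduces \<^const>\<open>stirling\<close> and \<^const>\<open>Stirling\<close> by their recurrences. We prove
  that they count the permutations with a given number of cycles (orbits, fixed points included)
  and the set partitions with a given number of blocks.\<close>

lemma orbit_transpose_comp:
  assumes p: "p permutes S" and a: "a \<notin> S" and b: "b \<in> S" and x: "x \<in> S"
  shows "orbit (transpose a b \<circ> p) x - {a} = orbit p x"
proof -
  define q where "q = transpose a b \<circ> p"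
  have pS: "p y \<in> S" if "y \<in> S" for y
    using that permutes_in_image[OF p] by simp
  have pa: "p a = a"
    using p a by (simp add: permutes_def)
  have qa: "q a = b"
    using pa by (simp add: q_def)
  have qy: "q y = (if p y = b then a else p y)" if "y \<in> S" for y
    using pS[OF that] a by (auto simp: transpose_def q_def)
  have orbS: "orbit p x \<subseteq> S"
    using permutes_orbit_subset[OF p x] .
  have "y \<in> orbit q x" if "y \<in> orbit p x" for y
    using that
  proof induction
    case base
    show ?case
    proof (cases "p x = b")
      case True
      then have "a \<in> orbit q x"
        using orbit.base[of q x] qy[OF x] by simp
      then show ?thesis
        using orbit.step[of a q x] qa True by simp
    next
      case False
      then show ?thesis
        using orbit.base[of q x] qy[OF x] by simp
    qed
  next
    case (step y)
    then have y: "y \<in> S" using orbS by blast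
    show ?case
    proof (cases "p y = b")
      case True
      then have "a \<in> orbit q x"
        using orbit.step[OF step.IH] qy[OF y] by simp
      then show ?thesis
        using orbit.step[of a q x] qa True by simp
    next
      case False
      then show ?thesis
        using orbit.step[OF step.IH] qy[OF y] by simp
    qed
  qed
  moreover have "y \<in> orbit p x \<or> y = a \<and> b \<in> orbit p x" if "y \<in> orbit q x" for y
    using that
  proof induction
    case base
    show ?case
      using orbit.base[of p x] qy[OF x] by (auto split: if_splits)
  next
    case (step y)
    then show ?case
    proof (elim disjE conjE)
      assume y: "y \<in> orbit p x"
      then have "y \<in> S" using orbS by blast
      then show ?case
        using orbit.step[OF y] qy by (auto split: if_splits)
    next
      assume "y = a" "b \<in> orbit p x"
      then show ?case using qa by simp
    qed
  qed
  ultimately show ?thesis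
    using orbS a unfolding q_def[symmetric] by blast
qed

lemma card_orbits_transpose_comp:
  assumes fin: "finite S" and p: "p permutes S" and a: "a \<notin> S" and b: "b \<in> insert a S"
  shows "card (orbit (transpose a b \<circ> p) ` insert a S) =
           (if b = a then Suc (card (orbit p ` S)) else card (orbit p ` S))"
proof (cases "b = a")
  case True
  have "p a = a"
    using p a by (simp add: permutes_def)
  then have "orbit p a = {a}"
    by (simp add: orbit_eq_singleton_iff)
  moreover have "{a} \<notin> orbit p ` S"
    using permutes_orbit_subset[OF p] a by auto
  ultimately show ?thesis
    using True fin by simp
next
  case False
  let ?q = "transpose a b \<circ> p"
  have bS: "b \<in> S" using b False by simp
  have "?q permutes insert a S"
    using permutes_insert[of a S] p b by auto
  then have perm: "permutation ?q"
    using fin permutes_imp_permutation[of "insert a S"] by simp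
  have "p a = a"
    using p a by (simp add: permutes_def)
  then have "orbit ?q a = orbit ?q b"
    using permutation_orbit_step[OF perm, of a] by simp
  then have "orbit ?q ` insert a S = orbit ?q ` S"
    using bS by auto
  moreover have "(\<lambda>X. X - {a}) ` orbit ?q ` S = orbit p ` S"
    using orbit_transpose_comp[OF p a bS] by (auto simp: image_image)
  moreover have "inj_on (\<lambda>X. X - {a}) (orbit ?q ` S)"
  proof (rule inj_onI, clarify)
    fix x y
    assume xy: "x \<in> S" "y \<in> S" and eq: "orbit ?q x - {a} = orbit ?q y - {a}"
    have "x \<in> orbit ?q x - {a}"
      using permutation_self_in_orbit[OF perm] xy a by auto
    then have "x \<in> orbit ?q y"
      using eq by blast
    then show "orbit ?q x = orbit ?q y"
      using orbit_cyclic_eq3[OF cyclic_on_orbit'[OF perm, of y]] by simp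
  qed
  ultimately show ?thesis
    using False by (metis card_image)
qed

lemma card_permutations_with_cycles:
  assumes "finite S"
  shows "card {p. p permutes S \<and> card (orbit p ` S) = k} = stirling (card S) k"
  using assms
proof (induction S arbitrary: k rule: finite_induct)
  case empty
  show ?case by (cases k) auto
next
  case (insert a S)
  let ?N = "\<lambda>k. {p. p permutes S \<and> card (orbit p ` S) = k}"
  let ?f = "\<lambda>(b, p). transpose a b \<circ> p"
  let ?A = "\<lambda>k. S \<times> ?N k"
  let ?B = "\<lambda>k. {a} \<times> {p. p permutes S \<and> Suc (card (orbit p ` S)) = k}"
  have finN: "finite {p. p permutes S \<and> Q p}" for Q
    using finite_permutations[OF insert.hyps(1)] by (rule rev_finite_subset) auto
  have inj: "inj_on ?f (insert a S \<times> {p. p permutes S})"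
  proof (rule inj_onI, clarify)
    fix b p c q
    assume p: "p permutes S" and q: "q permutes S"
      and eq: "transpose a b \<circ> p = transpose a c \<circ> q"
    have "p a = a" "q a = a"
      using p q insert.hyps(2) by (simp_all add: permutes_def)
    then have bc: "b = c"
      using fun_cong[OF eq, of a] by simp
    have "p x = q x" for x
      using fun_cong[OF eq, of x] bc by (metis comp_apply transpose_involutory)
    then show "b = c \<and> p = q" using bc by blast
  qed
  have "{p. p permutes insert a S \<and> card (orbit p ` insert a S) = k} = ?f ` (?A k \<union> ?B k)"
    (is "?L = ?R")
  proof (intro set_eqI iffI)
    fix q assume q: "q \<in> ?L"
    then have "q \<in> ?f ` {(b, p). b \<in> insert a S \<and> p \<in> {p. p permutes S}}"
      using permutes_insert[of a S] by blast
    then obtain b p where bp: "q = transpose a b \<circ> p" "b \<in> insert a S" "p permutes S"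
      by auto
    from card_orbits_transpose_comp[OF insert.hyps(1) bp(3) insert.hyps(2) bp(2)]
    have "(b, p) \<in> ?A k \<union> ?B k"
      using q bp insert.hyps(2) by (auto split: if_splits)
    then show "q \<in> ?R" using bp(1) by (intro image_eqI[of _ _ "(b, p)"]) auto
  next
    fix q assume "q \<in> ?R"
    then obtain b p where bp: "q = transpose a b \<circ> p" "(b, p) \<in> ?A k \<union> ?B k"
      by auto
    then have b: "b \<in> insert a S" and p: "p permutes S" by auto
    from card_orbits_transpose_comp[OF insert.hyps(1) p insert.hyps(2) b]
    have "card (orbit q ` insert a S) = k"
      using bp insert.hyps(2) by (auto split: if_splits)
    moreover have "q permutes insert a S"
      using permutes_insert[of a S] b p bp(1) by auto
    ultimately show "q \<in> ?L" by simp
  qed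
  moreover have "card (?f ` (?A k \<union> ?B k)) = card (?A k \<union> ?B k)"
    by (rule card_image, rule inj_on_subset[OF inj]) auto
  moreover have "card (?A k \<union> ?B k) = card (?A k) + card (?B k)"
    using insert.hyps finN by (intro card_Un_disjoint) auto
  ultimately have step: "card {p. p permutes insert a S \<and> card (orbit p ` insert a S) = k} =
      card S * card (?N k) + card {p. p permutes S \<and> Suc (card (orbit p ` S)) = k}"
    by (simp add: card_cartesian_product)
  show ?case
  proof (cases k)
    case 0
    have "card S * stirling (card S) 0 = 0" by (cases "card S") auto
    then show ?thesis
      using step insert 0 by simp
  next
    case (Suc l)
    then show ?thesis
      using step insert by simp
  qed
qed

corollary stirling_eq_card_permutations:
  "stirling n k = card {p. p permutes {..<n} \<and> card (orbit p ` {..<n}) = k}"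
  by (simp add: card_permutations_with_cycles)

lemma card_partitions_with_blocks:
  assumes "finite A"
  shows "card {P. partition_on A P \<and> card P = k} = Stirling (card A) k"
  using assms
proof (induction A arbitrary: k rule: finite_induct)
  case empty
  have "{P::'a set set. partition_on {} P \<and> card P = k} = (if k = 0 then {{}} else {})"
    by (auto simp: partition_on_empty)
  then show ?case by (cases k) (simp_all del: Collect_empty_eq)
next
  case (insert a A)
  let ?N = "\<lambda>k. {P. partition_on A P \<and> card P = k}"
  let ?g = "\<lambda>(Q, B). insert (insert a B) (Q - {B})"
  let ?S = "\<lambda>k. (SIGMA Q : ?N k. Q)"
  have finN: "finite (?N k)" for k
    using finitely_many_partition_on[OF insert.hyps(1)] by (rule rev_finite_subset) auto
  have finP: "finite P" if "partition_on A P" for P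
    using finite_elements[OF insert.hyps(1) that] .
  have blockA: "B \<subseteq> A" if "partition_on A P" "B \<in> P" for P B
    using partition_onD1[OF that(1)] that(2) by blast
  show ?case
  proof (cases k)
    case 0
    have "{P. partition_on (insert a A) P \<and> card P = 0} = {}"
    proof (rule ccontr)
      assume "\<not> ?thesis"
      then obtain P where P: "partition_on (insert a A) P" "card P = 0" by blast
      then have "finite P" using finite_elements insert.hyps(1) by blast
      then have "P = {}" using P by simp
      then show False using partition_onD1[OF P(1)] by simp
    qed
    then have "card {P. partition_on (insert a A) P \<and> card P = 0} = 0"
      by (simp only: card.empty)
    then show ?thesis using 0 insert.hyps(1,2) by simp
  next
    case (Suc l)
    have eq: "{P. partition_on (insert a A) P \<and> card P = k} = insert {a} ` ?N l \<union> ?g ` ?S k"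
      (is "?L = ?R")
    proof (intro set_eqI iffI)
      fix P assume "P \<in> ?L"
      then have P: "partition_on (insert a A) P" and cP: "card P = k" by auto
      have fin: "finite P" using finite_elements[OF _ P] insert.hyps(1) by simp
      obtain C where C: "C \<in> P" "a \<in> C"
        using partition_onD1[OF P] by blast
      let ?Q = "P - {C}"
      have disj: "disjnt C (\<Union>?Q)"
        using partition_onD2[OF P] C(1) by (auto simp: disjoint_def disjnt_def)
      have PQ: "insert C ?Q = P" using C by blast
      have Q: "partition_on (insert a A - C) ?Q" and CA: "C \<subseteq> insert a A"
        using partition_on_insert[OF disj, of "insert a A"] P unfolding PQ by blast+
      have cQ: "card ?Q = l" using cP Suc fin C(1) by simp
      show "P \<in> ?R"
      proof (cases "C = {a}")
        case True
        then have "?Q \<in> ?N l" using Q cQ insert.hyps(2) by simp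
        then show ?thesis using PQ True by blast
      next
        case False
        let ?B = "C - {a}"
        have B: "?B \<noteq> {}" "?B \<subseteq> A" using False C CA by auto
        have AB: "A - ?B = insert a A - C" using C insert.hyps(2) by auto
        have d: "disjnt ?B (\<Union>?Q)" using disj by (auto simp: disjnt_def)
        have "partition_on A (insert ?B ?Q)"
          using partition_on_insert[OF d, of A] B Q AB by simp
        moreover have BQ: "?B \<notin> ?Q"
          using d B(1) by (auto simp: disjnt_def)
        moreover have "card (insert ?B ?Q) = k"
          using cQ Suc fin BQ by (subst card_insert_disjoint) auto
        ultimately have "(insert ?B ?Q, ?B) \<in> ?S k" by simp
        moreover have "?g (insert ?B ?Q, ?B) = P"
        proof -
          have "insert a ?B = C" using C(2) by blast
          moreover have "insert ?B ?Q - {?B} = ?Q" using BQ by blast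
          ultimately show ?thesis using PQ by (simp only: prod.case)
        qed
        ultimately show ?thesis by (intro UnI2 image_eqI[of _ _ "(insert ?B ?Q, ?B)"]) simp_all
      qed
    next
      fix P assume "P \<in> ?R"
      then consider Q where "partition_on A Q" "card Q = l" "P = insert {a} Q"
        | Q B where "partition_on A Q" "card Q = k" "B \<in> Q" "P = insert (insert a B) (Q - {B})"
        by auto
      then show "P \<in> ?L"
      proof cases
        case 1
        have "disjnt {a} (\<Union>Q)"
          using partition_onD1[OF 1(1)] insert.hyps(2) by simp
        then have "partition_on (insert a A) P"
          using partition_on_insert[of "{a}" Q "insert a A"] 1 insert.hyps(2) by simp
        moreover have "{a} \<notin> Q" using blockA[OF 1(1)] insert.hyps(2) by blast
        ultimately show ?thesis
          using 1 Suc finP by simp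
      next
        case 2
        have dB: "disjnt B (\<Union>(Q - {B}))"
          using partition_onD2[OF 2(1)] 2(3) by (auto simp: disjoint_def disjnt_def)
        have "insert B (Q - {B}) = Q" using 2(3) by blast
        then have QB: "partition_on (A - B) (Q - {B})"
          using partition_on_insert[OF dB, of A] 2(1) by simp
        have "a \<notin> \<Union>Q" using partition_onD1[OF 2(1)] insert.hyps(2) by simp
        then have d: "disjnt (insert a B) (\<Union>(Q - {B}))"
          using dB by (auto simp: disjnt_def)
        have diff: "insert a A - insert a B = A - B"
          using insert.hyps(2) by auto
        have sub: "insert a B \<subseteq> insert a A" "insert a B \<noteq> {}"
          using blockA[OF 2(1,3)] by auto
        have "partition_on (insert a A) P"
          unfolding 2(4) partition_on_insert[OF d] diff using QB sub by (intro conjI)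
        moreover have "insert a B \<notin> Q" using \<open>a \<notin> \<Union>Q\<close> by blast
        moreover have "card (Q - {B}) = l" using 2 Suc finP by simp
        ultimately show ?thesis
          using 2 Suc finP by simp
      qed
    qed
    have inj1: "inj_on (insert {a}) (?N l)"
    proof (rule inj_onI)
      fix P Q assume PQ: "P \<in> ?N l" "Q \<in> ?N l" and e: "insert {a} P = insert {a} Q"
      have n: "{a} \<notin> R" if "R \<in> ?N l" for R
        using that blockA[of R "{a}"] insert.hyps(2) by auto
      show "P = Q" using e unfolding insert_ident[OF n[OF PQ(1)] n[OF PQ(2)]] .
    qed
    have inj2: "inj_on ?g (?S k)"
    proof (rule inj_onI, clarify)
      fix P B Q C
      assume P: "partition_on A P" "B \<in> P" and Q: "partition_on A Q" "C \<in> Q"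
        and e: "insert (insert a B) (P - {B}) = insert (insert a C) (Q - {C})"
      have aP: "a \<notin> X" if "X \<in> P" for X using blockA[OF P(1) that] insert.hyps(2) by blast
      have aQ: "a \<notin> X" if "X \<in> Q" for X using blockA[OF Q(1) that] insert.hyps(2) by blast
      have nP: "insert a B \<notin> P - {B}" and nQ: "insert a B \<notin> Q - {C}"
        using aP aQ by blast+
      have "insert a B \<in> insert (insert a C) (Q - {C})"
        unfolding e[symmetric] by (rule insertI1)
      then have eB: "insert a B = insert a C" using nQ by (elim insertE) (assumption, erule (1) notE)
      then have BC: "B = C" using insert_ident[OF aP[OF P(2)] aQ[OF Q(2)]] by simp
      have "P - {B} = Q - {C}"
        using e unfolding eB[symmetric] insert_ident[OF nP nQ] .
      then have "insert B (P - {B}) = insert C (Q - {C})" using BC by (simp only:)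
      then show "P = Q \<and> B = C" using BC insert_Diff[OF P(2)] insert_Diff[OF Q(2)] by (simp only:)
    qed
    have dis: "insert {a} ` ?N l \<inter> ?g ` ?S k = {}"
    proof (rule ccontr)
      assume "\<not> ?thesis"
      then obtain P Q B where P: "partition_on A P" and Q: "partition_on A Q" "B \<in> Q"
        and e: "insert {a} P = insert (insert a B) (Q - {B})" by auto
      have "{a} \<notin> Q" using blockA[OF Q(1)] insert.hyps(2) by blast
      moreover have "{a} \<in> insert (insert a B) (Q - {B})"
        unfolding e[symmetric] by (rule insertI1)
      ultimately have "insert a B = {a}" by auto
      then have "B = {}" using blockA[OF Q] insert.hyps(2) by blast
      then show False using partition_onD3[OF Q(1)] Q(2) by simp
    qed
    have finS: "finite (?S k)" using finN finP by (intro finite_SigmaI) auto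
    have "card (?S k) = (\<Sum>Q \<in> ?N k. card Q)"
      using finN finP by (intro card_SigmaI) auto
    also have "\<dots> = k * card (?N k)" by simp
    finally have cS: "card (?S k) = k * card (?N k)" .
    have "card {P. partition_on (insert a A) P \<and> card P = k} =
        card (insert {a} ` ?N l) + card (?g ` ?S k)"
      unfolding eq using finN finS dis by (intro card_Un_disjoint) auto
    also have "\<dots> = card (?N l) + k * card (?N k)"
      using card_image[OF inj1] card_image[OF inj2] cS by simp
    finally show ?thesis using insert Suc by simp
  qed
qed

corollary Stirling_eq_card_partitions:
  "Stirling n k = card {P. partition_on {..<n} P \<and> card P = k}"
  by (simp add: card_partitions_with_blocks)

end

theory Submission
  imports Defs "HOL-Library.Countable" "HOL-Real_Asymp.Real_Asymp"
begin

text \<open>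
  Both triangles satisfy \<open>A (n+1) k = w n k * A n k + A n (k-1)\<close>, where \<open>w n k\<close> is \<open>n\<close> for the first and
  \<open>k\<close> for the second kind, with \<open>A 0 0 = 1\<close> and zeros outside the triangle. Reading this forwards,
  \<open>A n k\<close> counts the walks that start from \<open>i = j = 0\<close>,
  consist of \<open>n\<close> steps, and end with \<open>j = k\<close>: each step increments \<open>i\<close>, and it either increments \<open>j\<close> as
  well or leaves \<open>j\<close> alone in one of \<open>w i j\<close> ways. A machine follows such a walk while it reads \<open>1\<^sup>n\<close>,
  keeping \<open>i\<close> and \<open>j\<close> in binary. After the separator it decrements \<open>j\<close> once per letter of \<open>1\<^sup>k\<close>, and it
  accepts if \<open>j\<close> becomes \<open>0\<close> exactly at the end of the input. The two counters share one work
  tape, each cell holding a digit of both, and their length is logarithmic.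

  The step with \<open>w i j\<close> ways is a single sweep over the tape, starting at the least significant digit.
  To have exactly \<open>v\<close> ways, where \<open>v\<close> is the number being scanned, the machine passes each digit while
  guessing a free bit, and at one digit that is set it may stop guessing; a sweep that never
  stops guessing is rejected. If the digit of weight \<open>2\<^sup>p\<close> is the chosen one, there are \<open>2\<^sup>p\<close> ways
  to have guessed below it, so the number of successful sweeps is the sum of \<open>2\<^sup>p\<close> over the digits set
  in \<open>v\<close>, which is \<open>v\<close> (\<open>run_Pick\<close>).

  The number of accepting paths, termination and the space bound are proved together: the
  inductive predicate \<open>yields\<close> asserts all three of a configuration, and it is established by going
  backwards through the computation, one rule application per machine step (\<open>counts_step\<close>). For an
  arbitrary input the machine has \<open>weight w x 0 0\<close> accepting paths (\<open>weight_in_sharpL\<close>), and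
  \<open>sum_weight\<close> identifies this number with the entry of the triangle.
\<close>

section \<open>Counting the accepting paths of a step relation\<close>

text \<open>\<open>yields R F sz B c m\<close>: from \<open>c\<close> there is no infinite \<open>R\<close>-path, all configurations \<open>d\<close> reachable
  from \<open>c\<close> have \<open>sz d \<le> B\<close>, and exactly \<open>m\<close> maximal paths from \<open>c\<close> end in a configuration satisfying \<open>F\<close>.
  The definition is the recursion for the number of paths; being inductive, it includes termination.\<close>

inductive yields ::
  "('c \<Rightarrow> 'c \<Rightarrow> bool) \<Rightarrow> ('c \<Rightarrow> bool) \<Rightarrow> ('c \<Rightarrow> nat) \<Rightarrow> real \<Rightarrow> 'c \<Rightarrow> nat \<Rightarrow> bool"
  for R F sz B where
  "real (sz c) \<le> B \<Longrightarrow> finite {c'. R c c'} \<Longrightarrow> (\<And>c'. R c c' \<Longrightarrow> yields R F sz B c' (f c')) \<Longrightarrow>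
   m = (if {c'. R c c'} = {} then of_bool (F c) else (\<Sum>c' | R c c'. f c')) \<Longrightarrow>
   yields R F sz B c m"

text \<open>The maximal paths from \<open>c\<close> whose last configuration satisfies \<open>F\<close>.\<close>

definition paths_from :: "('c \<Rightarrow> 'c \<Rightarrow> bool) \<Rightarrow> ('c \<Rightarrow> bool) \<Rightarrow> 'c \<Rightarrow> 'c list set" where
  "paths_from R F c =
     {cs. cs \<noteq> [] \<and> hd cs = c \<and> successively R cs \<and> (\<nexists>c'. R (last cs) c') \<and> F (last cs)}"

lemma Cons_in_paths_from:
  "d # cs \<in> paths_from R F c \<longleftrightarrow>
     d = c \<and> (if cs = [] then (\<nexists>c'. R c c') \<and> F c else \<exists>c'. R c c' \<and> cs \<in> paths_from R F c')"
  by (cases cs) (auto simp: paths_from_def)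

lemma paths_from_halting:
  "(\<nexists>c'. R c c') \<Longrightarrow> paths_from R F c = (if F c then {[c]} else {})"
  using Cons_in_paths_from[of _ _ R F c]
  by (intro set_eqI, rename_tac cs, case_tac cs) (auto simp: paths_from_def[of R F c])

lemma paths_from_step:
  assumes "R c c'"
  shows "paths_from R F c = (\<Union>c' \<in> {c'. R c c'}. Cons c ` paths_from R F c')"
proof (intro set_eqI)
  fix cs
  have ne: "[] \<notin> paths_from R F d" for d
    by (simp add: paths_from_def)
  show "cs \<in> paths_from R F c \<longleftrightarrow> cs \<in> (\<Union>c' \<in> {c'. R c c'}. Cons c ` paths_from R F c')"
    using assms ne by (cases cs) (auto simp: Cons_in_paths_from)
qed

lemma yields_paths:
  assumes "yields R F sz B c m"
  shows "finite (paths_from R F c) \<and> card (paths_from R F c) = m"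
  using assms
proof induction
  case (1 c f m)
  show ?case
  proof (cases "{c'. R c c'} = {}")
    case True
    then show ?thesis
      using 1(4) paths_from_halting[of R c F] by simp
  next
    case False
    then obtain c' where "R c c'" by blast
    then have paths: "paths_from R F c = (\<Union>c' \<in> {c'. R c c'}. Cons c ` paths_from R F c')"
      by (rule paths_from_step)
    have disj: "paths_from R F d \<inter> paths_from R F e = {}" if "d \<noteq> e" for d e
      using that by (auto simp: paths_from_def)
    have "card (paths_from R F c) = (\<Sum>c' | R c c'. card (Cons c ` paths_from R F c'))"
      unfolding paths using 1(2,5) disj by (intro card_UN_disjoint) auto
    also have "\<dots> = m"
      using False by (auto simp: card_image 1(4,5))
    finally show ?thesis
      unfolding paths using 1(2,5) by simp
  qed
qed

lemma yields_terminates: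
  assumes "yields R F sz B c m"
  shows "\<not> (f 0 = c \<and> (\<forall>i. R (f i) (f (Suc i))))"
  using assms
proof (induction arbitrary: f)
  case (1 c g m)
  show ?case
  proof
    assume f: "f 0 = c \<and> (\<forall>i. R (f i) (f (Suc i)))"
    then have "R c (f (Suc 0))" by metis
    from 1(5)[OF this, of "\<lambda>i. f (Suc i)"] show False
      using f by simp
  qed
qed

lemma yields_space:
  assumes "yields R F sz B c m" "R\<^sup>*\<^sup>* c d"
  shows "real (sz d) \<le> B"
  using assms
proof induction
  case (1 c f m)
  from 1(6) show ?case
    using 1(1,5) by (cases rule: converse_rtranclpE) auto
qed

section \<open>Machines with one work tape\<close>

text \<open>The machine with a single work tape given by a transition function \<open>\<delta>\<close> on arbitrary finite
  types of states and symbols, which are encoded as natural numbers. It has one accepting state \<open>qf\<close>,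
  and \<open>bl\<close> is the blank. An element \<open>(q', s', d, e)\<close> of \<open>\<delta> q a s\<close> consists of the new state, the symbol
  written, and the moves of the input head and of the work head.\<close>

definition one_tape ::
  "('q::finite \<Rightarrow> insym \<Rightarrow> 's::finite \<Rightarrow> ('q \<times> 's \<times> dir \<times> dir) set) \<Rightarrow> 'q \<Rightarrow> 'q \<Rightarrow> 's \<Rightarrow> (nat, nat) ntm"
where
  "one_tape \<delta> q0 qf bl =
     \<lparr>states = range (to_nat :: 'q \<Rightarrow> nat), symbols = range (to_nat :: 's \<Rightarrow> nat), blank = to_nat bl,
      tapes = 1, start = to_nat q0, accepting = {to_nat qf},
      trans = {((to_nat q, a, [to_nat s]), (to_nat q', [to_nat s'], d, [e])) | q a s q' s' d e.
                 (q', s', d, e) \<in> \<delta> q a s}\<rparr>"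

text \<open>State \<open>q\<close>, input head at \<open>h\<close>, work head at \<open>p\<close>, work tape \<open>t\<close>.\<close>

definition conf :: "'q::finite \<Rightarrow> nat \<Rightarrow> nat \<Rightarrow> (nat \<Rightarrow> 's::finite) \<Rightarrow> (nat, nat) config" where
  "conf q h p t = \<lparr>cstate = to_nat q, ihead = h, work = [(p, \<lambda>i. to_nat (t i))]\<rparr>"

lemma wf_one_tape: "wf_ntm (one_tape \<delta> q0 qf bl)"
  by (auto simp: wf_ntm_def one_tape_def)

lemma init_one_tape: "init_config (one_tape \<delta> q0 qf bl) = conf q0 0 0 (\<lambda>_. bl)"
  by (simp add: init_config_def one_tape_def conf_def)

lemma work_space_conf: "work_space (conf q h p t) = p + 1"
  by (simp add: work_space_def conf_def)

lemma step_one_tape: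
  "ntm_step (one_tape \<delta> q0 qf bl) x (conf q h p t) c' \<longleftrightarrow>
     (\<exists>(q', s', d, e) \<in> \<delta> q (read_input x h) (t p).
        c' = conf q' (min (move d h) (length x + 1)) (move e p) (t(p := s')))"
proof -
  have upd: "(\<lambda>i. to_nat (t i))(p := to_nat s') = (\<lambda>i. to_nat ((t(p := s')) i))" for s'
    by auto
  show ?thesis
    by (force simp: ntm_step_def one_tape_def conf_def upd simp del: fun_upd_apply)
qed

text \<open>Instance of \<^const>\<open>yields\<close> for the machine \<open>one_tape \<delta> q0 qf bl\<close> on the input \<open>x\<close>.\<close>

definition counts where
  "counts \<delta> q0 qf bl x B =
     yields (ntm_step (one_tape \<delta> q0 qf bl) x) (\<lambda>c. cstate c = to_nat qf) work_space B"

text \<open>If the possible transitions lead to pairwise distinct states, their successor configurations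
  are distinct, and the numbers of accepting paths add up.\<close>

lemma counts_step:
  fixes \<delta> :: "'q::finite \<Rightarrow> insym \<Rightarrow> 's::finite \<Rightarrow> ('q \<times> 's \<times> dir \<times> dir) set"
  assumes D: "\<delta> q (read_input x h) (t p) = D" "finite D" "inj_on fst D"
    and p: "real p + 1 \<le> B"
    and succ: "\<And>q' s' d e. (q', s', d, e) \<in> D \<Longrightarrow>
      counts \<delta> q0 qf bl x B (conf q' (min (move d h) (length x + 1)) (move e p) (t(p := s')))
        (f (q', s', d, e))"
    and m: "m = (if D = {} then of_bool (q = qf) else sum f D)"
  shows "counts \<delta> q0 qf bl x B (conf q h p t) m"
proof -
  define g where "g = (\<lambda>(q' :: 'q, s' :: 's, d, e).
    conf q' (min (move d h) (length x + 1)) (move e p) (t(p := s')))"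
  let ?R = "ntm_step (one_tape \<delta> q0 qf bl) x"
  have R: "{c'. ?R (conf q h p t) c'} = g ` D"
    unfolding step_one_tape D(1) by (force simp: g_def)
  have st: "cstate (g y) = to_nat (fst y)" for y
    by (simp add: g_def conf_def split: prod.split)
  have inj: "inj_on g D"
  proof (rule inj_onI)
    fix y z assume yz: "y \<in> D" "z \<in> D" and "g y = g z"
    then have "fst y = fst z"
      by (metis st to_nat_split)
    then show "y = z"
      using D(3) yz by (auto dest: inj_onD)
  qed
  show ?thesis
    unfolding counts_def
  proof (rule yields.intros[where f = "\<lambda>c. f (inv_into D g c)"])
    show "real (work_space (conf q h p t)) \<le> B"
      using p by (simp add: work_space_conf)
    show "finite {c'. ?R (conf q h p t) c'}"
      unfolding R using D(2) by simp
    show "yields ?R (\<lambda>c. cstate c = to_nat qf) work_space B c' (f (inv_into D g c'))"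
      if "?R (conf q h p t) c'" for c'
    proof -
      have "c' \<in> g ` D" using that R by blast
      then obtain y where y: "y \<in> D" "c' = g y" by blast
      then show ?thesis
        using succ[of "fst y" "fst (snd y)" "fst (snd (snd y))" "snd (snd (snd y))"]
        unfolding counts_def y(2) inv_into_f_f[OF inj y(1)] by (simp add: g_def case_prod_beta)
    qed
    have "cstate (conf q h p t) = to_nat qf \<longleftrightarrow> q = qf"
      by (simp add: conf_def)
    then show "m = (if {c'. ?R (conf q h p t) c'} = {} then of_bool (cstate (conf q h p t) = to_nat qf)
        else \<Sum>c' | ?R (conf q h p t) c'. f (inv_into D g c'))"
      unfolding R m using inj by (simp add: sum.reindex)
  qed
qed

lemma counts_step1:
  assumes "\<delta> q (read_input x h) (t p) = {(q', s', d, e)}" "real p + 1 \<le> B"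
    and "counts \<delta> q0 qf bl x B (conf q' (min (move d h) (length x + 1)) (move e p) (t(p := s'))) m"
  shows "counts \<delta> q0 qf bl x B (conf q h p t) m"
  by (rule counts_step[where f = "\<lambda>_. m" and D = "{(q', s', d, e)}"]) (use assms in auto)

lemma counts_halt:
  assumes "\<delta> q (read_input x h) (t p) = {}" "real p + 1 \<le> B"
  shows "counts \<delta> q0 qf bl x B (conf q h p t) (of_bool (q = qf))"
  by (rule counts_step[where D = "{}"]) (use assms in auto)

lemma sharpL_one_tape:
  fixes \<delta> :: "'q::finite \<Rightarrow> insym \<Rightarrow> 's::finite \<Rightarrow> ('q \<times> 's \<times> dir \<times> dir) set"
  assumes s: "s \<in> O(\<lambda>n. ln (real n))"
    and yields: "\<And>x. counts \<delta> q0 qf bl x (s (length x)) (conf q0 0 0 (\<lambda>_. bl)) (f x)"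
  shows "f \<in> sharpL"
proof -
  let ?M = "one_tape \<delta> q0 qf bl"
  have y: "yields (ntm_step ?M x) (\<lambda>c. cstate c = to_nat qf) work_space (s (length x))
      (init_config ?M) (f x)" for x
    using yields[of x] by (simp add: counts_def init_one_tape)
  have "accepting_paths ?M x =
      paths_from (ntm_step ?M x) (\<lambda>c. cstate c = to_nat qf) (init_config ?M)" for x
    by (auto simp: accepting_paths_def computation_paths_def paths_from_def halting_def
        one_tape_def)
  then have "f x = card (accepting_paths ?M x)" for x
    using yields_paths[OF y] by simp
  moreover have "runs_in_space ?M s"
    unfolding runs_in_space_def using yields_space[OF y] by blast
  moreover have "halts_on_every_path ?M x" for x
    unfolding halts_on_every_path_def using yields_terminates[OF y] by blast
  ultimately show ?thesis
    unfolding sharpL_def using wf_one_tape s by blast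
qed

section \<open>Binary counters with two tracks\<close>

text \<open>A list of digits, least significant digit first, represents two numbers \<open>val fst zs\<close> and
  \<open>val snd zs\<close> in binary.\<close>

type_synonym digit = "bool \<times> bool"

fun val :: "(digit \<Rightarrow> bool) \<Rightarrow> digit list \<Rightarrow> nat" where
  "val u [] = 0"
| "val u (z # zs) = of_bool (u z) + 2 * val u zs"

text \<open>\<open>incr c d\<close> adds the carry \<open>c\<close> to the first and the carry \<open>d\<close> to the second number; \<open>decr c\<close>
  subtracts the borrow \<open>c\<close> from the second number. Only \<open>incr\<close> can make the list
  longer, and a borrow left over at its end is dropped by \<open>decr\<close>.\<close>

fun incr :: "bool \<Rightarrow> bool \<Rightarrow> digit list \<Rightarrow> digit list" where
  "incr c d [] = (if c \<or> d then [(c, d)] else [])"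
| "incr c d ((a, b) # zs) = (a \<noteq> c, b \<noteq> d) # incr (a \<and> c) (b \<and> d) zs"

fun decr :: "bool \<Rightarrow> digit list \<Rightarrow> digit list" where
  "decr c [] = []"
| "decr c ((a, b) # zs) = (a, b \<noteq> c) # decr (c \<and> \<not> b) zs"

lemma val_incr:
  "val fst (incr c d zs) = val fst zs + of_bool c"
  "val snd (incr c d zs) = val snd zs + of_bool d"
  by (induction c d zs rule: incr.induct) auto

lemma length_decr [simp]: "length (decr c zs) = length zs"
  by (induction c zs rule: decr.induct) auto

lemma val_decr:
  "of_bool c \<le> val snd zs \<Longrightarrow> val snd (decr c zs) = val snd zs - of_bool c"
  by (induction c zs rule: decr.induct) (auto simp: of_bool_def split: if_splits)

text \<open>The length of the list is logarithmic in the sum of the two numbers.\<close>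

definition no_waste :: "digit list \<Rightarrow> bool" where
  "no_waste zs \<longleftrightarrow> 2 ^ length zs \<le> 2 * (val fst zs + val snd zs) + 1"

lemma length_incr:
  "length (incr c d zs) = length zs \<or>
   length (incr c d zs) = Suc (length zs) \<and>
     2 ^ length zs \<le> val fst (incr c d zs) + val snd (incr c d zs)"
  by (induction c d zs rule: incr.induct) auto

lemma no_waste_incr: "no_waste zs \<Longrightarrow> no_waste (incr c d zs)"
  using length_incr[of c d zs] val_incr[of c d zs] by (auto simp: no_waste_def)

section \<open>The machine\<close>

text \<open>Cell \<open>0\<close> of the work tape holds \<open>Mark\<close>, the counters occupy the cells from \<open>1\<close> on, and the rest is
  blank.

  In state \<open>Scan sep\<close> the work head is on the mark and the next input letter is examined;
  \<open>sep\<close> tells whether the separator \<open>0\<close> has been passed. The states \<open>Add\<close>, \<open>Pick\<close> and \<open>Dec\<close> sweep to the right: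
  \<open>Add c d\<close> adds its carries to the two counters; \<open>Pick g c\<close> adds \<open>c\<close> to the first counter and has not yet
  chosen a set digit, \<open>g\<close> being the bit guessed last; \<open>Dec c\<close> subtracts \<open>c\<close> from the second counter.
  \<open>Back sep\<close> returns to the mark and then advances the input head. Recording \<open>g\<close> in the state makes
  different guesses different computation paths.\<close>

datatype symbol = Blank | Mark | Cell digit

datatype state = Init | Scan bool | Pick bool bool | Add bool bool | Dec bool | Back bool | Acc

instance symbol :: finite
proof
  have "(UNIV :: symbol set) = {Blank, Mark} \<union> range Cell"
    by (auto intro: symbol.exhaust)
  then show "finite (UNIV :: symbol set)"
    by (metis finite.emptyI finite.insertI finite_Un finite_imageI finite)
qed

instance state :: finite
proof
  let ?A = "{Init, Acc} \<union> range Scan \<union> range Dec \<union> range Back \<union>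
      range (\<lambda>(g, c). Pick g c) \<union> range (\<lambda>(c, d). Add c d)"
  have "q \<in> ?A" for q :: state
    by (cases q) auto
  then have "UNIV \<subseteq> ?A"
    by blast
  moreover have "finite ?A"
    by simp
  ultimately show "finite (UNIV :: state set)"
    by (rule finite_subset)
qed

text \<open>The parameter \<open>u\<close> selects the counter that \<open>Pick\<close> draws from. At the right end of the input, the
  machine tests the second counter for zero by trying to decrement it: it accepts if a borrow is left
  over. While letters of the second block remain, a leftover borrow means rejection instead.\<close>

definition delta ::
  "(digit \<Rightarrow> bool) \<Rightarrow> state \<Rightarrow> insym \<Rightarrow> symbol \<Rightarrow> (state \<times> symbol \<times> dir \<times> dir) set"
where
  "delta u q a s =
     (case q of
        Init \<Rightarrow> (if a = LeftEnd then {(Scan False, Mark, Rgt, Stay)} else {})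
      | Scan sep \<Rightarrow>
          (case a of
             Bit True \<Rightarrow>
               (if sep then {(Dec True, Mark, Stay, Rgt)}
                else {(Add True True, Mark, Stay, Rgt), (Pick False True, Mark, Stay, Rgt)})
           | Bit False \<Rightarrow> (if sep then {} else {(Scan True, Mark, Rgt, Stay)})
           | RightEnd \<Rightarrow> (if sep then {(Dec True, Mark, Stay, Rgt)} else {})
           | LeftEnd \<Rightarrow> {})
      | Add c d \<Rightarrow>
          (case s of
             Cell (a, b) \<Rightarrow> {(Add (a \<and> c) (b \<and> d), Cell (a \<noteq> c, b \<noteq> d), Stay, Rgt)}
           | _ \<Rightarrow> {(Back False, if c \<or> d then Cell (c, d) else Blank, Stay, Lft)})
      | Pick g c \<Rightarrow>
          (case s of
             Cell (a, b) \<Rightarrow>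
               {(Pick False (a \<and> c), Cell (a \<noteq> c, b), Stay, Rgt),
                (Pick True (a \<and> c), Cell (a \<noteq> c, b), Stay, Rgt)} \<union>
               (if u (a, b) then {(Add (a \<and> c) False, Cell (a \<noteq> c, b), Stay, Rgt)} else {})
           | _ \<Rightarrow> {})
      | Dec c \<Rightarrow>
          (case s of
             Cell (a, b) \<Rightarrow> {(Dec (c \<and> \<not> b), Cell (a, b \<noteq> c), Stay, Rgt)}
           | _ \<Rightarrow>
               (if c then (if a = RightEnd then {(Acc, Blank, Stay, Stay)} else {})
                else (if a = RightEnd then {} else {(Back True, Blank, Stay, Lft)})))
      | Back sep \<Rightarrow>
          (case s of
             Mark \<Rightarrow> {(Scan sep, Mark, Rgt, Stay)}
           | _ \<Rightarrow> {(Back sep, s, Stay, Lft)})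
      | Acc \<Rightarrow> {})"

lemma delta_simps [simp]:
  "delta u Init LeftEnd s = {(Scan False, Mark, Rgt, Stay)}"
  "delta u (Scan False) (Bit True) s =
     {(Add True True, Mark, Stay, Rgt), (Pick False True, Mark, Stay, Rgt)}"
  "delta u (Scan False) (Bit False) s = {(Scan True, Mark, Rgt, Stay)}"
  "delta u (Scan False) RightEnd s = {}"
  "delta u (Scan True) (Bit True) s = {(Dec True, Mark, Stay, Rgt)}"
  "delta u (Scan True) (Bit False) s = {}"
  "delta u (Scan True) RightEnd s = {(Dec True, Mark, Stay, Rgt)}"
  "delta u (Add c d) i (Cell (a, b)) =
     {(Add (a \<and> c) (b \<and> d), Cell (a \<noteq> c, b \<noteq> d), Stay, Rgt)}"
  "delta u (Add c d) i Blank =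
     {(Back False, if c \<or> d then Cell (c, d) else Blank, Stay, Lft)}"
  "delta u (Pick g c) i (Cell (a, b)) =
     {(Pick False (a \<and> c), Cell (a \<noteq> c, b), Stay, Rgt),
      (Pick True (a \<and> c), Cell (a \<noteq> c, b), Stay, Rgt)} \<union>
     (if u (a, b) then {(Add (a \<and> c) False, Cell (a \<noteq> c, b), Stay, Rgt)} else {})"
  "delta u (Pick g c) i Blank = {}"
  "delta u (Dec c) i (Cell (a, b)) = {(Dec (c \<and> \<not> b), Cell (a, b \<noteq> c), Stay, Rgt)}"
  "delta u (Dec c) RightEnd Blank = (if c then {(Acc, Blank, Stay, Stay)} else {})"
  "i \<noteq> RightEnd \<Longrightarrow> delta u (Dec c) i Blank = (if c then {} else {(Back True, Blank, Stay, Lft)})"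
  "delta u (Back sep) i Mark = {(Scan sep, Mark, Rgt, Stay)}"
  "delta u (Back sep) i (Cell z) = {(Back sep, Cell z, Stay, Lft)}"
  "delta u Acc i s = {}"
  by (auto simp: delta_def)

text \<open>The work tape that holds the counters \<open>zs\<close>.\<close>

definition tape :: "digit list \<Rightarrow> nat \<Rightarrow> symbol" where
  "tape zs p = (case p of 0 \<Rightarrow> Mark | Suc i \<Rightarrow> if i < length zs then Cell (zs ! i) else Blank)"

lemma tape_simps [simp]:
  "tape zs 0 = Mark"
  "tape zs (Suc (length zs)) = Blank"
  "tape (us @ z # vs) (Suc (length us)) = Cell z"
  "(tape zs)(0 := Mark) = tape zs"
  "(tape zs)(Suc (length zs) := Blank) = tape zs"
  "(tape zs)(Suc (length zs) := Cell z) = tape (zs @ [z])"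
  "(tape (us @ z # vs))(Suc (length us) := Cell z') = tape (us @ z' # vs)"
  by (auto simp: tape_def fun_eq_iff nth_append less_Suc_eq split: nat.split)

lemma tape_Nil: "(\<lambda>_. Blank)(0 := Mark) = tape []"
  by (auto simp: tape_def fun_eq_iff split: nat.split)

section \<open>The sweeps\<close>

text \<open>\<open>run u x B q h p zs m\<close>: with the counters \<open>zs\<close> on the tape, there are \<open>m\<close> accepting paths from state
  \<open>q\<close> and head positions \<open>h\<close> and \<open>p\<close>, in space \<open>B\<close>. In the lemmas on the sweeps, \<open>us\<close> are the digits already
  processed and \<open>vs\<close> those to come.\<close>

abbreviation run where
  "run u x B q h p zs m \<equiv> counts (delta u) Init Acc Blank x B (conf q h p (tape zs)) m"

lemma run_Back:
  assumes "run u x B (Scan sep) (Suc h) 0 zs m" "h \<le> length x" "p \<le> length zs" "real p + 1 \<le> B"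
  shows "run u x B (Back sep) h p zs m"
  using assms
proof (induction p)
  case 0
  show ?case
    by (rule counts_step1[where q' = "Scan sep" and s' = Mark and d = Rgt and e = Stay])
      (use 0 in auto)
next
  case (Suc p)
  then have t: "tape zs (Suc p) = Cell (zs ! p)"
    by (simp add: tape_def)
  then have t': "(tape zs)(Suc p := Cell (zs ! p)) = tape zs"
    by auto
  show ?case
    by (rule counts_step1[where q' = "Back sep"
            and s' = "Cell (zs ! p)" and d = Stay and e = Lft])
      (use Suc t t' in auto)
qed

lemma run_Add:
  assumes "run u x B (Back False) h (length us + length vs) (us @ incr c d vs) m"
    and "h \<le> length x" "real (length us + length vs) + 2 \<le> B"
  shows "run u x B (Add c d) h (Suc (length us)) (us @ vs) m"
  using assms
proof (induction vs arbitrary: us c d)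
  case Nil
  show ?case
    by (rule counts_step1[where q' = "Back False"
            and s' = "if c \<or> d then Cell (c, d) else Blank" and d = Stay and e = Lft])
      (use Nil in auto)
next
  case (Cons z vs)
  obtain a b where z: "z = (a, b)" by fastforce
  show ?case
    by (rule counts_step1[where q' = "Add (a \<and> c) (b \<and> d)"
            and s' = "Cell (a \<noteq> c, b \<noteq> d)" and d = Stay and e = Rgt])
      (use Cons.prems Cons.IH[of "us @ [(a \<noteq> c, b \<noteq> d)]" "a \<and> c" "b \<and> d"] in
        \<open>auto simp: z\<close>)
qed

text \<open>The count \<open>v\<close> of the successful continuations satisfies Horner's recursion
  \<open>v (z # vs) = of_bool (u z) + 2 * v vs\<close>: two guesses, or the choice of this digit.\<close>

lemma run_Pick:
  assumes "run u x B (Back False) h (length us + length vs) (us @ incr c False vs) m"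
    and "h \<le> length x" "real (length us + length vs) + 2 \<le> B"
  shows "run u x B (Pick g c) h (Suc (length us)) (us @ vs) (val u vs * m)"
  using assms
proof (induction vs arbitrary: us c g)
  case Nil
  then have "run u x B (Pick g c) h (Suc (length us)) (us @ []) (of_bool (Pick g c = Acc))"
    by (intro counts_halt) auto
  then show ?case by simp
next
  case (Cons z vs)
  obtain a b where z: "z = (a, b)" by fastforce
  let ?us = "us @ [(a \<noteq> c, b)]"
  have pick: "run u x B (Pick g' (a \<and> c)) h (Suc (length ?us)) (?us @ vs) (val u vs * m)" for g'
    using Cons.prems by (intro Cons.IH) (auto simp: z)
  have add: "run u x B (Add (a \<and> c) False) h (Suc (length ?us)) (?us @ vs) m"
    using Cons.prems by (intro run_Add) (auto simp: z)
  let ?D = "{(Pick False (a \<and> c), Cell (a \<noteq> c, b), Stay, Rgt),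
      (Pick True (a \<and> c), Cell (a \<noteq> c, b), Stay, Rgt)} \<union>
    (if u z then {(Add (a \<and> c) False, Cell (a \<noteq> c, b), Stay, Rgt)} else {})"
  have D: "delta u (Pick g c) (read_input x h) (Cell z) = ?D"
    by (simp add: z)
  let ?f = "\<lambda>(q', _). case q' of Add _ _ \<Rightarrow> m | _ \<Rightarrow> val u vs * m"
  show ?case
  proof (rule counts_step[where D = ?D and f = ?f])
    show "delta u (Pick g c) (read_input x h) (tape (us @ z # vs) (Suc (length us))) = ?D"
      using D by simp
    show "finite ?D" "inj_on fst ?D" by (simp_all split: if_splits)
    show "real (Suc (length us)) + 1 \<le> B" using Cons.prems by simp
    show "counts (delta u) Init Acc Blank x B
        (conf q' (min (move d h) (length x + 1)) (move e (Suc (length us)))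
          ((tape (us @ z # vs))(Suc (length us) := s'))) (?f (q', s', d, e))"
      if "(q', s', d, e) \<in> ?D" for q' s' d e
      using that add pick[of False] pick[of True] Cons.prems(2) by (auto split: if_splits)
    show "val u (z # vs) * m = (if ?D = {} then of_bool (Pick g c = Acc) else sum ?f ?D)"
      by (simp add: algebra_simps)
  qed
qed

lemma run_Dec:
  assumes "of_bool c \<le> val snd vs \<Longrightarrow>
      run u x B (Back True) h (length us + length vs) (us @ decr c vs) m"
    and "h \<le> length x" "read_input x h \<noteq> RightEnd" "real (length us + length vs) + 2 \<le> B"
  shows "run u x B (Dec c) h (Suc (length us)) (us @ vs) (of_bool (of_bool c \<le> val snd vs) * m)"
  using assms
proof (induction vs arbitrary: us c)
  case Nil
  show ?case
  proof (cases c)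
    case True
    then have "run u x B (Dec c) h (Suc (length us)) (us @ []) (of_bool (Dec c = Acc))"
      using Nil by (intro counts_halt) auto
    then show ?thesis using True by simp
  next
    case False
    show ?thesis
      by (rule counts_step1[where q' = "Back True"
              and s' = Blank and d = Stay and e = Lft])
        (use Nil False in auto)
  qed
next
  case (Cons z vs)
  obtain a b where z: "z = (a, b)" by fastforce
  have le: "of_bool c \<le> val snd (z # vs) \<longleftrightarrow> of_bool (c \<and> \<not> b) \<le> val snd vs"
    by (auto simp: z of_bool_def split: if_splits)
  show ?case
    unfolding le
    by (rule counts_step1[where q' = "Dec (c \<and> \<not> b)"
            and s' = "Cell (a, b \<noteq> c)" and d = Stay and e = Rgt])
      (use Cons.prems Cons.IH[of "c \<and> \<not> b" "us @ [(a, b \<noteq> c)]"] in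
        \<open>auto simp: z le[unfolded z]\<close>)
qed

text \<open>At the right end of the input, the sweep is a test whether the second counter is smaller than the
  borrow.\<close>

lemma run_Dec_RightEnd:
  assumes "read_input x h = RightEnd" "h = Suc (length x)" "real (length us + length vs) + 2 \<le> B"
  shows "run u x B (Dec c) h (Suc (length us)) (us @ vs) (of_bool (val snd vs < of_bool c))"
  using assms
proof (induction vs arbitrary: us c)
  case Nil
  show ?case
  proof (cases c)
    case True
    have acc: "run u x B Acc h (Suc (length us)) us (of_bool (Acc = Acc))"
      using Nil by (intro counts_halt) auto
    show ?thesis
      by (rule counts_step1[where q' = Acc and s' = Blank and d = Stay and e = Stay])
        (use Nil True acc in auto)
  next
    case False
    then have "run u x B (Dec c) h (Suc (length us)) (us @ []) (of_bool (Dec c = Acc))"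
      using Nil by (intro counts_halt) auto
    then show ?thesis using False by simp
  qed
next
  case (Cons z vs)
  obtain a b where z: "z = (a, b)" by fastforce
  have less: "val snd (z # vs) < of_bool c \<longleftrightarrow> val snd vs < of_bool (c \<and> \<not> b)"
    by (auto simp: z of_bool_def split: if_splits)
  show ?case
    unfolding less
    by (rule counts_step1[where q' = "Dec (c \<and> \<not> b)"
            and s' = "Cell (a, b \<noteq> c)" and d = Stay and e = Rgt])
      (use Cons.prems Cons.IH[of "us @ [(a, b \<noteq> c)]" "c \<and> \<not> b"] in \<open>auto simp: z\<close>)
qed

section \<open>The whole computation\<close>

lemma read_input_simps [simp]:
  "read_input (pre @ b # ys) (Suc (length pre)) = Bit b"
  "read_input xs (Suc (length xs)) = RightEnd"
  by (auto simp: read_input_def)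

text \<open>In the second phase the computation is deterministic, and it accepts if and only if the rest of
  the input is \<open>1\<^sup>j\<close>, where \<open>j\<close> is the second counter.\<close>

lemma run_Scan_True:
  assumes "x = pre @ ys" "real (length zs) + 2 \<le> B"
  shows "run u x B (Scan True) (Suc (length pre)) 0 zs (of_bool (ys = replicate (val snd zs) True))"
  using assms
proof (induction ys arbitrary: pre zs)
  case Nil
  \<comment> \<open>A sweep starts with no digits processed, in cell \<open>Suc (length [])\<close>.\<close>
  have dec: "run u x B (Dec True) (Suc (length x)) (Suc (length ([]::digit list))) ([] @ zs)
      (of_bool (val snd zs < of_bool True))"
    using Nil by (intro run_Dec_RightEnd) auto
  show ?case
    by (rule counts_step1[where q' = "Dec True" and s' = Mark and d = Stay and e = Rgt])
      (use Nil dec in auto)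
next
  case (Cons b ys)
  show ?case
  proof (cases b)
    case False
    then have "run u x B (Scan True) (Suc (length pre)) 0 zs (of_bool (Scan True = Acc))"
      using Cons.prems by (intro counts_halt) auto
    then show ?thesis
      using False by (cases "val snd zs") auto
  next
    case True
    let ?m = "of_bool (ys = replicate (val snd zs - 1) True)"
    have "run u x B (Back True) (Suc (length pre)) (length ([]::digit list) + length zs)
        ([] @ decr True zs) ?m" if "of_bool True \<le> val snd zs"
      using Cons.prems True that Cons.IH[of "pre @ [b]" "decr True zs"] val_decr[of True zs]
      by (intro run_Back) auto
    then have dec: "run u x B (Dec True) (Suc (length pre)) (Suc (length ([]::digit list))) ([] @ zs)
        (of_bool (of_bool True \<le> val snd zs) * ?m)"
      using Cons.prems by (intro run_Dec) auto
    have m: "of_bool (of_bool True \<le> val snd zs) * ?m =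
        (of_bool (b # ys = replicate (val snd zs) True) :: nat)"
      using True by (cases "val snd zs") auto
    show ?thesis
      by (rule counts_step1[where q' = "Dec True" and s' = Mark and d = Stay and e = Rgt])
        (use Cons.prems True dec[unfolded m] in auto)
  qed
qed

text \<open>The number of accepting paths on the remaining input when the counters hold \<open>i\<close> and \<open>j\<close> and the
  separator has not been passed. Inputs without a separator are rejected.\<close>

fun weight :: "(nat \<Rightarrow> nat \<Rightarrow> nat) \<Rightarrow> bool list \<Rightarrow> nat \<Rightarrow> nat \<Rightarrow> nat" where
  "weight w [] i j = 0"
| "weight w (True # ys) i j = w i j * weight w ys (Suc i) j + weight w ys (Suc i) (Suc j)"
| "weight w (False # ys) i j = of_bool (ys = replicate j True)"

text \<open>Each letter read so far has increased the sum of the counters by at most \<open>2\<close>; so the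
  length \<open>l\<close> of the counters satisfies \<open>2\<^sup>l \<le> 4 |x| + 1\<close>.\<close>

lemma run_Scan_False:
  assumes w: "\<And>zs. val u zs = w (val fst zs) (val snd zs)"
    and B: "\<And>l. 2 ^ l \<le> 4 * length x + 1 \<Longrightarrow> real l + 2 \<le> B"
    and "x = pre @ ys" "no_waste zs" "val fst zs + val snd zs \<le> 2 * length pre"
  shows "run u x B (Scan False) (Suc (length pre)) 0 zs (weight w ys (val fst zs) (val snd zs))"
  using assms(3-)
proof (induction ys arbitrary: pre zs)
  case (Cons b ys)
  have space: "real (length zs) + 2 \<le> B"
    using Cons.prems by (intro B) (auto simp: no_waste_def)
  show ?case
  proof (cases b)
    case False
    show ?thesis
      by (rule counts_step1[where q' = "Scan True" and s' = Mark and d = Rgt and e = Stay])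
        (use Cons.prems False space run_Scan_True[of x "pre @ [b]" ys zs B u] in auto)
  next
    case True
    let ?v = "\<lambda>d. weight w ys (Suc (val fst zs)) (val snd zs + of_bool d)"
    have rewind: "run u x B (Back False) (Suc (length pre)) (length ([]::digit list) + length zs)
        ([] @ incr True d zs) (?v d)" for d
      using Cons.prems True Cons.IH[of "pre @ [b]" "incr True d zs"] length_incr[of True d zs]
        val_incr[of True d zs] no_waste_incr[of zs True d] space
      by (intro run_Back) (auto simp: of_bool_def split: if_splits)
    have add: "run u x B (Add True True) (Suc (length pre)) (Suc (length ([]::digit list))) ([] @ zs)
        (?v True)"
      using Cons.prems space by (intro run_Add rewind) auto
    have pick: "run u x B (Pick False True) (Suc (length pre)) (Suc (length ([]::digit list)))
        ([] @ zs) (val u zs * ?v False)"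
      using Cons.prems space by (intro run_Pick rewind) auto
    let ?D = "{(Add True True, Mark, Stay, Rgt), (Pick False True, Mark, Stay, Rgt)}"
    have D: "delta u (Scan False) (Bit True) Mark = ?D"
      by simp
    show ?thesis
      by (rule counts_step[where D = ?D and
            f = "\<lambda>(q', _). case q' of Add _ _ \<Rightarrow> ?v True | _ \<Rightarrow> val u zs * ?v False"])
        (use Cons.prems space True add pick D in \<open>auto simp: w\<close>)
  qed
next
  case Nil
  have "0 \<le> B" using B[of 0] by simp
  moreover have "real (length zs) + 2 \<le> B"
    using Nil by (intro B) (auto simp: no_waste_def)
  ultimately have "run u x B (Scan False) (Suc (length pre)) 0 zs (of_bool (Scan False = Acc))"
    using Nil by (intro counts_halt) auto
  then show ?case by simp
qed

lemma weight_in_sharpL: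
  assumes w: "\<And>zs. val u zs = w (val fst zs) (val snd zs)"
  shows "(\<lambda>x. weight w x 0 0) \<in> sharpL"
proof (rule sharpL_one_tape)
  show "(\<lambda>n. log 2 (4 * real n + 1) + 2) \<in> O(\<lambda>n. ln (real n))"
    by real_asymp
  fix x :: "bool list"
  let ?B = "log 2 (4 * real (length x) + 1) + 2"
  have B: "real l + 2 \<le> ?B" if "2 ^ l \<le> 4 * length x + 1" for l
  proof -
    have "2 ^ l \<le> 4 * real (length x) + 1"
      using of_nat_mono[OF that, where 'a = real] by simp
    then show ?thesis
      by (simp add: le_log_iff powr_realpow)
  qed
  have scan: "run u x ?B (Scan False) (Suc (length ([] :: bool list))) 0 []
      (weight w x (val fst []) (val snd []))"
    by (rule run_Scan_False[OF w B]) (auto simp: no_waste_def)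
  show "counts (delta u) Init Acc Blank x ?B (conf Init 0 0 (\<lambda>_. Blank)) (weight w x 0 0)"
    by (rule counts_step1[where q' = "Scan False"
            and s' = Mark and d = Rgt and e = Stay])
      (use B[of 0] scan in \<open>auto simp: read_input_def tape_Nil\<close>)
qed

section \<open>Triangular recurrences\<close>

lemma on_unary_pairs_simps:
  "on_unary_pairs g [] = 0"
  "on_unary_pairs g (False # ys) = (if ys = replicate (length ys) True then g 0 (length ys) else 0)"
  "on_unary_pairs g (True # ys) = on_unary_pairs (\<lambda>n. g (Suc n)) ys"
proof -
  show "on_unary_pairs g [] = 0"
    by (rule on_unary_pairs_other) simp
  show "on_unary_pairs g (False # ys) = (if ys = replicate (length ys) True then g 0 (length ys) else 0)"
  proof (cases "ys = replicate (length ys) True")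
    case True
    then show ?thesis
      using on_unary_pairs_unary_pair[of g 0 "length ys"] by simp
  next
    case False
    have "False # ys \<noteq> replicate n True @ [False] @ replicate k True" for n k
      using False by (cases n) auto
    then show ?thesis using False by (simp add: on_unary_pairs_other)
  qed
  show "on_unary_pairs g (True # ys) = on_unary_pairs (\<lambda>n. g (Suc n)) ys"
  proof (cases "\<exists>n k. ys = replicate n True @ [False] @ replicate k True")
    case True
    then obtain n k where "ys = replicate n True @ [False] @ replicate k True" by blast
    then show ?thesis
      using on_unary_pairs_unary_pair[of g "Suc n" k]
        on_unary_pairs_unary_pair[of "\<lambda>n. g (Suc n)" n k] by simp
  next
    case False
    have "True # ys \<noteq> replicate n True @ [False] @ replicate k True" for n k
      using False by (cases n) auto
    then show ?thesis using False by (simp add: on_unary_pairs_other)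
  qed
qed

text \<open>Splitting the walks after their first \<open>i\<close> steps: for every \<open>j\<close> there are \<open>A i j\<close> initial parts that
  lead to \<open>j\<close>, and \<open>weight w ys i j\<close> continuations.\<close>

lemma sum_weight:
  assumes A0: "\<And>n. A (Suc n) 0 = w n 0 * A n 0"
    and A: "\<And>n k. A (Suc n) (Suc k) = w n (Suc k) * A n (Suc k) + A n k"
    and above: "\<And>n k. n < k \<Longrightarrow> A n k = 0"
  shows "(\<Sum>j\<le>i. A i j * weight w ys i j) = on_unary_pairs (\<lambda>n. A (i + n)) ys"
proof (induction ys arbitrary: i)
  case Nil
  then show ?case by (simp add: on_unary_pairs_simps)
next
  case (Cons b ys)
  show ?case
  proof (cases b)
    case False
    have eq: "ys = replicate j True \<longleftrightarrow> ys = replicate (length ys) True \<and> j = length ys" for j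
      by auto
    have "(\<Sum>j\<le>i. A i j * of_bool (ys = replicate j True)) =
        of_bool (ys = replicate (length ys) True) * (\<Sum>j\<le>i. if j = length ys then A i j else 0)"
      unfolding sum_distrib_left by (intro sum.cong refl) (subst eq, auto)
    also have "\<dots> = (if ys = replicate (length ys) True then A i (length ys) else 0)"
      using above[of i "length ys"] by auto
    finally show ?thesis
      using False by (simp add: on_unary_pairs_simps)
  next
    case True
    let ?G = "\<lambda>j. weight w ys (Suc i) j"
    have "(\<Sum>j\<le>Suc i. A (Suc i) j * ?G j) =
        w i 0 * A i 0 * ?G 0 + (\<Sum>j\<le>i. (w i (Suc j) * A i (Suc j) + A i j) * ?G (Suc j))"
      by (simp add: sum.atMost_Suc_shift A0 A del: sum.atMost_Suc)
    also have "\<dots> = (\<Sum>j\<le>Suc i. w i j * A i j * ?G j) + (\<Sum>j\<le>i. A i j * ?G (Suc j))"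
      by (simp add: sum.atMost_Suc_shift algebra_simps sum.distrib del: sum.atMost_Suc)
    also have "(\<Sum>j\<le>Suc i. w i j * A i j * ?G j) = (\<Sum>j\<le>i. w i j * A i j * ?G j)"
      using above by simp
    finally have "(\<Sum>j\<le>i. A i j * weight w (True # ys) i j) = (\<Sum>j\<le>Suc i. A (Suc i) j * ?G j)"
      by (simp add: algebra_simps sum.distrib del: sum.atMost_Suc)
    then show ?thesis
      using True Cons.IH[of "Suc i"] by (simp add: on_unary_pairs_simps)
  qed
qed

lemma triangle_in_sharpL:
  assumes "\<And>zs. val u zs = w (val fst zs) (val snd zs)"
    and "A 0 0 = 1" "\<And>n. A (Suc n) 0 = w n 0 * A n 0"
    and "\<And>n k. A (Suc n) (Suc k) = w n (Suc k) * A n (Suc k) + A n k"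
    and "\<And>n k. n < k \<Longrightarrow> A n k = 0"
  shows "on_unary_pairs A \<in> sharpL"
proof -
  have "on_unary_pairs A = (\<lambda>x. weight w x 0 0)"
    using sum_weight[of A w 0] assms by (auto simp: fun_eq_iff)
  then show ?thesis
    using weight_in_sharpL[of u w] assms(1) by simp
qed

theorem corollary3p11:
  shows "on_unary_pairs stirling \<in> sharpL \<and> on_unary_pairs Stirling \<in> sharpL"
proof
  have "n * stirling n 0 = 0" for n
    by (cases n) auto
  then show "on_unary_pairs stirling \<in> sharpL"
    by (intro triangle_in_sharpL[where u = fst and w = "\<lambda>i j. i"]) auto
  show "on_unary_pairs Stirling \<in> sharpL"
    by (intro triangle_in_sharpL[where u = snd and w = "\<lambda>i j. j"]) auto
qed

end
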